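(* Let $\sigma:\Sigma\to\Sigma$ be a one-sided countable state Markov shift with set of states $S$, let $G$ be a finitely generated countable group, let $\psi:\Sigma\to G$ be a function depending only on the first coordinate, $\psi((x_i)_{i=1}^\infty)=\psi(x_1)$, and suppose that the skew product extension $T_\psi:\Sigma\times G\to\Sigma\times G$, $T_\psi(x,g)=(\sigma x,g\psi(x))$, is topologically transitive. Let $\varphi:\Sigma\to\mathbb{R}$ be locally Hölder continuous. If $G$ is amenable, then $$P_{\mathrm G}(\varphi,T_\psi)=P_{\mathrm G}(\varphi,T_{\bar\psi}),$$ where $T_{\bar\psi}:\Sigma\times\overline G\to\Sigma\times\overline G$ is the abelianized skew product.
   Context: Countable state Markov shift: $S$ is a countable set, $A$ is an $S\times S$ matrix with entries in $\{0,1\}$, $\Sigma=\{x=(x_i)_{i=1}^\infty: x_i\in S,\ A(x_i,x_{i+1})=1\ \forall i\ge 1\}$ with the topology generated by cylinders, and $(\sigma x)_i=x_{i+1}$. A word $w=(w_1,\dots,w_n)\in S^n$ is allowed if $A(w_i,w_{i+1})=1$ for $1\le i\le n-1$; $\mathcal W_n$ is the set of allowed words of length $n$, and $[w]=\{x\in\Sigma: x_i=w_i,\ 1\le i\le n\}$. A map is topologically transitive if there is a point with a dense orbit. $\varphi:\Sigma\to\mathbb{R}$ is locally Hölder continuous if there are $C>0$ and $0<\theta<1$ with $\sup_{w\in\mathcal W_n}\sup_{x,y\in[w]}|\varphi(x)-\varphi(y)|\le C\theta^n$ for all $n\ge1$. Write $\varphi^n=\sum_{j=0}^{n-1}\varphi\circ\sigma^j$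 and $\psi_n(x)=\psi(x)\psi(\sigma x)\cdots\psi(\sigma^{n-1}x)$. $G$ carries the discrete topology and has identity $e$. $\overline G$ is the torsion-free part of the abelianization $G^{\mathrm{ab}}$, i.e. the quotient of $G^{\mathrm{ab}}$ by its torsion subgroup (so $\overline G\cong\mathbb{Z}^d$ for some $d\ge0$), written additively; $\pi:G\to\overline G$ is the projection homomorphism, $\bar\psi=\pi\circ\psi$, and $T_{\bar\psi}(x,m)=(\sigma x,m+\bar\psi(x))$. (If $d=0$, $T_{\bar\psi}$ is regarded as $\sigma$.) Write $\bar\psi^n=\sum_{j=0}^{n-1}\bar\psi\circ\sigma^j$. The skew products $T_\psi$, $T_{\bar\psi}$ are themselves countable state Markov shifts (with states $S\times G$, $S\times\overline G$), and $\varphi$ is regarded as a function on $\Sigma\times G$ and on $\Sigma\times\overline G$ depending only on the first factor. Their Gurevič pressures, in $\mathbb{R}\cup\{\infty\}$, are $$P_{\mathrm G}(\varphi,T_\psi)=\limsup_{n\to\infty}\frac1n\log\sum_{\substack{\sigma^nx=x,\ x_1=a\\ \psi_n(x)=e}}e^{\varphi^n(x)},\qquad P_{\mathrm G}(\varphi,T_{\bar\psi})=\limsup_{n\to\infty}\frac1n\log\sum_{\substack{\sigma^nx=x,\ x_1=a\\ \bar\psi^n(x)=0}}e^{\varphi^n(x)},$$ for any choice of $a\in S$ (the values do not depend on $a$). *)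

theory Defs
  imports "HOL-Analysis.Analysis" "HOL-Algebra.Generated_Groups"
begin

section \<open>Countable state Markov shifts\<close>

text \<open>Sequences are indexed from \<open>0\<close>: the first coordinate of \<open>x\<close> is \<open>x 0\<close>.\<close>

definition shift_space :: "'s set \<Rightarrow> ('s \<Rightarrow> 's \<Rightarrow> nat) \<Rightarrow> (nat \<Rightarrow> 's) set" where
  "shift_space S A = {x. (\<forall>i. x i \<in> S) \<and> (\<forall>i. A (x i) (x (Suc i)) = 1)}"

definition shift :: "(nat \<Rightarrow> 's) \<Rightarrow> (nat \<Rightarrow> 's)" where
  "shift x = (\<lambda>i. x (Suc i))"

definition allowed_words :: "'s set \<Rightarrow> ('s \<Rightarrow> 's \<Rightarrow> nat) \<Rightarrow> nat \<Rightarrow> 's list set" where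
  "allowed_words S A n =
     {w. length w = n \<and> set w \<subseteq> S \<and> (\<forall>i. Suc i < n \<longrightarrow> A (w ! i) (w ! Suc i) = 1)}"

definition cylinder :: "'s set \<Rightarrow> ('s \<Rightarrow> 's \<Rightarrow> nat) \<Rightarrow> 's list \<Rightarrow> (nat \<Rightarrow> 's) set" where
  "cylinder S A w = {x \<in> shift_space S A. \<forall>i < length w. x i = w ! i}"

definition shift_topology :: "'s set \<Rightarrow> ('s \<Rightarrow> 's \<Rightarrow> nat) \<Rightarrow> (nat \<Rightarrow> 's) topology" where
  "shift_topology S A =
     topology_generated_by {cylinder S A w | w n. n \<ge> 1 \<and> w \<in> allowed_words S A n}"

definition locally_Holder ::
    "'s set \<Rightarrow> ('s \<Rightarrow> 's \<Rightarrow> nat) \<Rightarrow> ((nat \<Rightarrow> 's) \<Rightarrow> real) \<Rightarrow> bool" where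
  "locally_Holder S A \<phi> \<longleftrightarrow>
     (\<exists>C > 0. \<exists>\<theta>. 0 < \<theta> \<and> \<theta> < 1 \<and>
        (\<forall>n \<ge> 1. \<forall>w \<in> allowed_words S A n. \<forall>x \<in> cylinder S A w. \<forall>y \<in> cylinder S A w.
           \<bar>\<phi> x - \<phi> y\<bar> \<le> C * \<theta> ^ n))"

definition birkhoff_sum :: "((nat \<Rightarrow> 's) \<Rightarrow> real) \<Rightarrow> nat \<Rightarrow> (nat \<Rightarrow> 's) \<Rightarrow> real" where
  "birkhoff_sum \<phi> n x = (\<Sum>j<n. \<phi> ((shift ^^ j) x))"

definition topologically_transitive :: "'x topology \<Rightarrow> ('x \<Rightarrow> 'x) \<Rightarrow> bool" where
  "topologically_transitive X T \<longleftrightarrow>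
     (\<exists>p \<in> topspace X. X closure_of {(T ^^ n) p | n. True} = topspace X)"


section \<open>Finitely generated and amenable groups, torsion-free abelianization\<close>

definition fin_gen_group :: "('g, 'm) monoid_scheme \<Rightarrow> bool" where
  "fin_gen_group G \<longleftrightarrow> (\<exists>F. finite F \<and> F \<subseteq> carrier G \<and> generate G F = carrier G)"

text \<open>Existence of a left-invariant mean on the bounded real functions on \<open>G\<close>. Functions live on the
  whole type; positivity refers to the carrier only, so by linearity the value of \<open>M\<close> on a bounded
  function depends only on its restriction to the carrier.\<close>

definition amenable_group :: "('g, 'm) monoid_scheme \<Rightarrow> bool" where
  "amenable_group G \<longleftrightarrow>
     (let B = {f :: 'g \<Rightarrow> real. bounded (f ` carrier G)} in
      \<exists>M :: ('g \<Rightarrow> real) \<Rightarrow> real.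
        (\<forall>f \<in> B. \<forall>h \<in> B. M (\<lambda>x. f x + h x) = M f + M h) \<and>
        (\<forall>f \<in> B. \<forall>c. M (\<lambda>x. c * f x) = c * M f) \<and>
        (\<forall>f \<in> B. (\<forall>x \<in> carrier G. 0 \<le> f x) \<longrightarrow> 0 \<le> M f) \<and>
        M (\<lambda>x. 1) = 1 \<and>
        (\<forall>f \<in> B. \<forall>g \<in> carrier G. M (\<lambda>x. f (g \<otimes>\<^bsub>G\<^esub> x)) = M f))"

definition abelianization :: "('g, 'm) monoid_scheme \<Rightarrow> 'g set monoid" where
  "abelianization G = G Mod derived G (carrier G)"

definition torsion_subgroup :: "('g, 'm) monoid_scheme \<Rightarrow> 'g set" where
  "torsion_subgroup H = {x \<in> carrier H. \<exists>n::nat. n > 0 \<and> x [^]\<^bsub>H\<^esub> n = \<one>\<^bsub>H\<^esub>}"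

text \<open>The quotient \<open>\<Gamma>\<close> of the abelianization by its torsion subgroup, with the projection
  \<open>\<pi> : G \<rightarrow> \<Gamma>\<close>. Quotients are written multiplicatively, so the neutral element of \<open>\<Gamma>\<close>
  is \<open>\<one>\<close> rather than \<open>0\<close>.\<close>

definition tf_abelianization :: "('g, 'm) monoid_scheme \<Rightarrow> 'g set set monoid" where
  "tf_abelianization G = abelianization G Mod torsion_subgroup (abelianization G)"

definition tf_proj :: "('g, 'm) monoid_scheme \<Rightarrow> 'g \<Rightarrow> 'g set set" where
  "tf_proj G g =
     torsion_subgroup (abelianization G) #>\<^bsub>abelianization G\<^esub> (derived G (carrier G) #>\<^bsub>G\<^esub> g)"


section \<open>Skew products and their Gurevic pressure\<close>

definition skew_product ::
    "('g, 'm) monoid_scheme \<Rightarrow> ((nat \<Rightarrow> 's) \<Rightarrow> 'g) \<Rightarrow> (nat \<Rightarrow> 's) \<times> 'g \<Rightarrow> (nat \<Rightarrow> 's) \<times> 'g" where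
  "skew_product G \<psi> = (\<lambda>(x, g). (shift x, g \<otimes>\<^bsub>G\<^esub> \<psi> x))"

definition skew_topology ::
    "'s set \<Rightarrow> ('s \<Rightarrow> 's \<Rightarrow> nat) \<Rightarrow> ('g, 'm) monoid_scheme \<Rightarrow> ((nat \<Rightarrow> 's) \<times> 'g) topology" where
  "skew_topology S A G = prod_topology (shift_topology S A) (discrete_topology (carrier G))"

text \<open>\<open>cocycle G \<psi> n x\<close> is the ordered product \<open>\<psi> x \<cdot> \<psi> (\<sigma> x) \<cdots> \<psi> (\<sigma>\<^sup>n\<^sup>-\<^sup>1 x)\<close>, with
  \<open>\<sigma>\<close> the shift.\<close>

primrec cocycle ::
    "('g, 'm) monoid_scheme \<Rightarrow> ((nat \<Rightarrow> 's) \<Rightarrow> 'g) \<Rightarrow> nat \<Rightarrow> (nat \<Rightarrow> 's) \<Rightarrow> 'g" where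
  "cocycle G \<psi> 0 x = \<one>\<^bsub>G\<^esub>"
| "cocycle G \<psi> (Suc n) x = cocycle G \<psi> n x \<otimes>\<^bsub>G\<^esub> \<psi> ((shift ^^ n) x)"

definition eln :: "ennreal \<Rightarrow> ereal" where
  "eln s = (if s = 0 then -\<infinity> else if s = \<infinity> then \<infinity> else ereal (ln (enn2real s)))"

text \<open>The sum ranges over a possibly infinite set and may diverge, so it is taken in
  \<open>[0, \<infinity>]\<close>.\<close>

definition gurevic_pressure ::
    "'s set \<Rightarrow> ('s \<Rightarrow> 's \<Rightarrow> nat) \<Rightarrow> ((nat \<Rightarrow> 's) \<Rightarrow> real) \<Rightarrow>
     ('g, 'm) monoid_scheme \<Rightarrow> ((nat \<Rightarrow> 's) \<Rightarrow> 'g) \<Rightarrow> 's \<Rightarrow> ereal" where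
  "gurevic_pressure S A \<phi> G \<psi> a =
     limsup (\<lambda>n. ereal (1 / real n) *
       eln (\<Sum>\<^sub>\<infinity>x \<in> {x \<in> shift_space S A.
                     (shift ^^ n) x = x \<and> x 0 = a \<and> cocycle G \<psi> n x = \<one>\<^bsub>G\<^esub>}.
              ennreal (exp (birkhoff_sum \<phi> n x))))"

end

theory Submission
  imports Defs
begin

text \<open>Let \<open>W n g\<close> be the weight of the loops at \<open>a\<close> of length \<open>n\<close> with cocycle \<open>g\<close>. For
  \<open>s < exp (- P)\<close>, with \<open>P\<close> the pressure over \<open>G\<close>, the Green function \<open>h g = (\<Sum>n. s\<^sup>n W n g)\<close> is
  finite and positive. Prepending the loops \<open>x\<close> of a fixed length \<open>n\<close> shows that the sum of
  \<open>s\<^sup>n weight n x h (g\<^sub>x\<inverse> g)\<close>, with \<open>g\<^sub>x\<close> the cocycle of \<open>x\<close>, is at most a constant times \<open>h g\<close>,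
  the constant being independent of \<open>n\<close>. An invariant mean of \<open>g \<mapsto> ln (h (t g) / h g)\<close> is a
  homomorphism in \<open>t\<close> from \<open>G\<close> to the reals, hence vanishes on the kernel of the projection
  to the torsion-free abelianization. By Jensen's inequality the total weight of the loops of
  length \<open>n\<close> with cocycle in that kernel is \<open>O(s\<^sup>-\<^sup>n)\<close>.\<close>

section \<open>Characters from invariant means\<close>

text \<open>The target is commutative, so a real-valued homomorphism kills every commutator;
  induction over \<open>generate\<close> extends this to the derived subgroup.\<close>

lemma (in group) additive_hom_facts:
  fixes \<xi> :: "'a \<Rightarrow> real"
  assumes add: "\<And>x y. x \<in> carrier G \<Longrightarrow> y \<in> carrier G \<Longrightarrow> \<xi> (x \<otimes> y) = \<xi> x + \<xi> y"
  shows additive_hom_one: "\<xi> \<one> = 0"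
    and additive_hom_inv: "x \<in> carrier G \<Longrightarrow> \<xi> (inv x) = - \<xi> x"
    and additive_hom_pow: "x \<in> carrier G \<Longrightarrow> \<xi> (x [^] (n::nat)) = real n * \<xi> x"
    and additive_hom_derived: "y \<in> derived G (carrier G) \<Longrightarrow> \<xi> y = 0"
proof -
  show one: "\<xi> \<one> = 0"
    using add[of \<one> \<one>] by simp
  show inv_eq: "\<xi> (inv x) = - \<xi> x" if "x \<in> carrier G" for x
    using add[of x "inv x"] that one by simp
  show "\<xi> (x [^] n) = real n * \<xi> x" if "x \<in> carrier G"
    using that by (induction n) (auto simp: one add algebra_simps)
  show "\<xi> y = 0" if "y \<in> derived G (carrier G)"
  proof -
    have in_carr: "z \<in> carrier G" if "z \<in> derived_set G (carrier G)" for z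
      using that by auto
    have comm: "\<xi> z = 0" if "z \<in> derived_set G (carrier G)" for z
      using that by (auto simp: add inv_eq)
    have "y \<in> generate G (derived_set G (carrier G))"
      using that by (simp add: derived_def)
    then show ?thesis
    proof induction
      case (eng h1 h2)
      then have "h1 \<in> carrier G" "h2 \<in> carrier G"
        using generate_in_carrier[of "derived_set G (carrier G)"] in_carr by blast+
      with eng show ?case by (simp add: add)
    next
      case (inv k)
      then show ?case using inv_eq[OF in_carr] comm by simp
    qed (simp_all add: one comm)
  qed
qed

text \<open>\<open>tf_proj\<close> is the composite of two quotient maps. An element of its kernel
  has a torsion class in the abelianization, and a power of that class being trivial means that the
  same power of the element lies in the derived subgroup.\<close>

lemma (in group) tf_proj_facts:
  shows group_tf_abelianization: "group (tf_abelianization G)"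
    and tf_proj_hom: "tf_proj G \<in> hom G (tf_abelianization G)"
    and tf_proj_eq_one:
      "g \<in> carrier G \<Longrightarrow> tf_proj G g = \<one>\<^bsub>tf_abelianization G\<^esub> \<Longrightarrow>
         \<exists>n::nat. n > 0 \<and> g [^] n \<in> derived G (carrier G)"
proof -
  define D where "D = derived G (carrier G)"
  define H where "H = abelianization G"
  interpret D: normal D G
    unfolding D_def by (rule derived_self_is_normal)
  interpret H: comm_group H
    unfolding H_def abelianization_def by (rule derived_quot_is_comm_group)
  have projD: "(\<lambda>g. D #> g) \<in> hom G H"
    using D.r_coset_hom_Mod by (simp add: H_def abelianization_def D_def)
  have "subgroup (torsion_subgroup H) H"
  proof (rule H.subgroupI)
    have "\<one>\<^bsub>H\<^esub> \<in> torsion_subgroup H"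
      by (auto simp: torsion_subgroup_def intro!: exI[of _ "1::nat"])
    then show "torsion_subgroup H \<noteq> {}" by blast
    show "inv\<^bsub>H\<^esub> x \<in> torsion_subgroup H" if "x \<in> torsion_subgroup H" for x
      using that by (auto simp: torsion_subgroup_def H.nat_pow_inv)
    show "x \<otimes>\<^bsub>H\<^esub> y \<in> torsion_subgroup H"
      if x: "x \<in> torsion_subgroup H" and y: "y \<in> torsion_subgroup H" for x y
    proof -
      from x obtain m :: nat where m: "x \<in> carrier H" "m > 0" "x [^]\<^bsub>H\<^esub> m = \<one>\<^bsub>H\<^esub>"
        by (auto simp: torsion_subgroup_def)
      from y obtain n :: nat where n: "y \<in> carrier H" "n > 0" "y [^]\<^bsub>H\<^esub> n = \<one>\<^bsub>H\<^esub>"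
        by (auto simp: torsion_subgroup_def)
      have "x [^]\<^bsub>H\<^esub> (m * n) = \<one>\<^bsub>H\<^esub>" "y [^]\<^bsub>H\<^esub> (n * m) = \<one>\<^bsub>H\<^esub>"
        using m n by (metis H.nat_pow_pow H.nat_pow_one)+
      then have "(x \<otimes>\<^bsub>H\<^esub> y) [^]\<^bsub>H\<^esub> (m * n) = \<one>\<^bsub>H\<^esub>"
        using m n by (simp add: H.pow_mult_distrib H.m_comm mult.commute)
      then show ?thesis
        using m n by (auto simp: torsion_subgroup_def intro!: exI[of _ "m * n"])
    qed
  qed (auto simp: torsion_subgroup_def)
  then interpret T: normal "torsion_subgroup H" H
    by (rule H.subgroup_imp_normal)
  have tfH: "tf_abelianization G = H Mod torsion_subgroup H"
    by (simp add: tf_abelianization_def H_def)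
  have tfp: "tf_proj G = (\<lambda>X. torsion_subgroup H #>\<^bsub>H\<^esub> X) \<circ> (\<lambda>g. D #> g)"
    by (auto simp: tf_proj_def H_def D_def)
  show "group (tf_abelianization G)"
    unfolding tfH by (rule T.factorgroup_is_group)
  show "tf_proj G \<in> hom G (tf_abelianization G)"
    unfolding tfH tfp by (rule Group.hom_compose[OF projD T.r_coset_hom_Mod])
  assume g: "g \<in> carrier G" and eq: "tf_proj G g = \<one>\<^bsub>tf_abelianization G\<^esub>"
  have X: "D #> g \<in> carrier H"
    using hom_in_carrier[OF projD g] .
  have "torsion_subgroup H #>\<^bsub>H\<^esub> (D #> g) = torsion_subgroup H"
    using eq by (simp add: tfH tfp)
  then have "D #> g \<in> torsion_subgroup H"
    using H.rcos_self[OF X T.subgroup_axioms] by simp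
  then obtain n :: nat where n: "n > 0" "(D #> g) [^]\<^bsub>H\<^esub> n = \<one>\<^bsub>H\<^esub>"
    unfolding torsion_subgroup_def by blast
  have hom: "group_hom G H (\<lambda>g. D #> g)"
    by (intro group_hom.intro group_hom_axioms.intro projD group_axioms H.group_axioms)
  have "D #> (g [^] n) = D"
    using n(2) group_hom.hom_nat_pow[OF hom g, of n]
    by (metis H_def abelianization_def D_def one_FactGroup)
  then have "g [^] n \<in> D"
    using rcos_self[OF _ D.subgroup_axioms, of "g [^] n"] g by simp
  then show "\<exists>n::nat. n > 0 \<and> g [^] n \<in> derived G (carrier G)"
    using n by (auto simp: D_def)
qed

text \<open>Some positive power of \<open>g\<close> lies in the derived subgroup, where
  \<open>\<xi>\<close> vanishes; as the reals have no torsion, \<open>n * \<xi> g = 0\<close> forces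
  \<open>\<xi> g = 0\<close>.\<close>

lemma (in group) additive_hom_tf_proj_eq_one:
  fixes \<xi> :: "'a \<Rightarrow> real"
  assumes add: "\<And>x y. x \<in> carrier G \<Longrightarrow> y \<in> carrier G \<Longrightarrow> \<xi> (x \<otimes> y) = \<xi> x + \<xi> y"
    and g: "g \<in> carrier G" "tf_proj G g = \<one>\<^bsub>tf_abelianization G\<^esub>"
  shows "\<xi> g = 0"
proof -
  obtain n :: nat where "n > 0" "g [^] n \<in> derived G (carrier G)"
    using tf_proj_eq_one[OF g] by blast
  then show ?thesis
    using additive_hom_derived[OF add, where y = "g [^] n"] additive_hom_pow[OF add g(1), of n] by auto
qed

text \<open>The character is \<open>\<xi> t = M (\<lambda>x. ln (h (t x) / h x))\<close> for an invariant mean \<open>M\<close>. Since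
  \<open>exp u \<ge> 1 + u\<close>, applying \<open>M\<close> to \<open>C \<ge> (\<Sum>i. v i * h (t i * x) / h x)\<close> linearizes the bound.\<close>

lemma (in group) amenable_character:
  fixes h :: "'a \<Rightarrow> real"
  assumes amen: "amenable_group G"
    and pos: "\<And>x. x \<in> carrier G \<Longrightarrow> h x > 0"
    and harnack: "\<And>t. t \<in> carrier G \<Longrightarrow> \<exists>c. \<forall>x\<in>carrier G. h (t \<otimes> x) \<le> c * h x"
  shows "\<exists>\<xi> :: 'a \<Rightarrow> real.
    (\<forall>x\<in>carrier G. \<forall>y\<in>carrier G. \<xi> (x \<otimes> y) = \<xi> x + \<xi> y) \<and>
    (\<forall>(I :: 'i set) v t C. finite I \<longrightarrow> (\<forall>i\<in>I. v i \<ge> 0) \<longrightarrow> (\<forall>i\<in>I. t i \<in> carrier G) \<longrightarrow>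
       (\<forall>x\<in>carrier G. (\<Sum>i\<in>I. v i * h (t i \<otimes> x)) \<le> C * h x) \<longrightarrow>
       (\<Sum>i\<in>I. v i * (1 + \<xi> (t i))) \<le> C)"
proof -
  define B where "B = {f :: 'a \<Rightarrow> real. bounded (f ` carrier G)}"
  obtain M :: "('a \<Rightarrow> real) \<Rightarrow> real" where M:
    "(\<forall>f \<in> B. \<forall>k \<in> B. M (\<lambda>x. f x + k x) = M f + M k) \<and>
     (\<forall>f \<in> B. \<forall>c. M (\<lambda>x. c * f x) = c * M f) \<and>
     (\<forall>f \<in> B. (\<forall>x \<in> carrier G. 0 \<le> f x) \<longrightarrow> 0 \<le> M f) \<and>
     M (\<lambda>x. 1) = 1 \<and>
     (\<forall>f \<in> B. \<forall>g \<in> carrier G. M (\<lambda>x. f (g \<otimes> x)) = M f)"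
    using amen unfolding amenable_group_def Let_def B_def[symmetric] by (elim exE)
  have M_add: "M (\<lambda>x. f x + k x) = M f + M k" if "f \<in> B" "k \<in> B" for f k
    using M that by simp
  have M_scale: "M (\<lambda>x. c * f x) = c * M f" if "f \<in> B" for f c
    using M that by simp
  have M_pos: "0 \<le> M f" if "f \<in> B" "\<And>x. x \<in> carrier G \<Longrightarrow> 0 \<le> f x" for f
    using M that by simp
  have M_one: "M (\<lambda>x. 1) = 1"
    using M by simp
  have M_inv: "M (\<lambda>x. f (g \<otimes> x)) = M f" if "f \<in> B" "g \<in> carrier G" for f g
    using M that by simp
  have B_iff: "f \<in> B \<longleftrightarrow> (\<exists>c. \<forall>x\<in>carrier G. \<bar>f x\<bar> \<le> c)" for f
    by (auto simp: B_def bounded_iff)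
  have B_I: "f \<in> B" if "\<And>x. x \<in> carrier G \<Longrightarrow> \<bar>f x\<bar> \<le> c" for f and c :: real
    unfolding B_iff by (rule exI[of _ c]) (use that in simp)
  have B_const: "(\<lambda>x. c) \<in> B" for c
    by (auto simp: B_iff)
  have B_add: "(\<lambda>x. f x + k x) \<in> B" if "f \<in> B" "k \<in> B" for f k
  proof -
    obtain c where c: "\<forall>x\<in>carrier G. \<bar>f x\<bar> \<le> c"
      using \<open>f \<in> B\<close> unfolding B_iff by (elim exE)
    obtain d where d: "\<forall>x\<in>carrier G. \<bar>k x\<bar> \<le> d"
      using \<open>k \<in> B\<close> unfolding B_iff by (elim exE)
    have "\<bar>f x + k x\<bar> \<le> c + d" if "x \<in> carrier G" for x
      using bspec[OF c that] bspec[OF d that] by linarith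
    then show ?thesis by (rule B_I)
  qed
  have B_scale: "(\<lambda>x. c * f x) \<in> B" if "f \<in> B" for c f
  proof -
    obtain d where d: "\<forall>x\<in>carrier G. \<bar>f x\<bar> \<le> d"
      using \<open>f \<in> B\<close> unfolding B_iff by (elim exE)
    have "\<bar>c * f x\<bar> \<le> \<bar>c\<bar> * d" if "x \<in> carrier G" for x
      unfolding abs_mult by (rule mult_left_mono[OF bspec[OF d that] abs_ge_zero])
    then show ?thesis by (rule B_I)
  qed
  have M_mono: "M f \<le> M k" if "f \<in> B" "k \<in> B" "\<And>x. x \<in> carrier G \<Longrightarrow> f x \<le> k x" for f k
  proof -
    have B': "(\<lambda>x. (-1) * f x) \<in> B" by (rule B_scale[OF that(1)])
    have "0 \<le> M (\<lambda>x. k x + (-1) * f x)"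
      by (rule M_pos[OF B_add[OF that(2) B']]) (use that(3) in auto)
    also have "\<dots> = M k - M f"
      using M_add[OF that(2) B'] M_scale[OF that(1), of "-1"] by simp
    finally show ?thesis by simp
  qed
  \<comment> \<open>Functions live on the whole type, whereas the estimates below hold only on the
    carrier. Positivity of \<open>M\<close> refers to the carrier alone, so agreement there is
    enough.\<close>
  have M_cong: "M f = M k" if "f \<in> B" "\<And>x. x \<in> carrier G \<Longrightarrow> f x = k x" for f k
  proof -
    have "k \<in> B" using that by (simp add: B_iff)
    then show ?thesis using M_mono[of f k] M_mono[of k f] that by (simp add: antisym)
  qed
  have M_sum: "(\<lambda>x. \<Sum>i\<in>I. v i * f i x) \<in> B \<and> M (\<lambda>x. \<Sum>i\<in>I. v i * f i x) = (\<Sum>i\<in>I. v i * M (f i))"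
    if "finite I" "\<And>i. i \<in> I \<Longrightarrow> f i \<in> B" for I :: "'i set" and v f
    using that
  proof (induction I)
    case empty
    show ?case using B_const[of 0] M_scale[OF B_const[of 0], of 0] by simp
  next
    case (insert j I)
    then have j: "(\<lambda>x. v j * f j x) \<in> B" by (simp add: B_scale)
    have I: "(\<lambda>x. \<Sum>i\<in>I. v i * f i x) \<in> B" using insert by blast
    show ?case
      using insert B_add[OF j I] M_add[OF j I] M_scale by simp
  qed
  define u where "u t x = ln (h (t \<otimes> x) / h x)" for t x
  define \<xi> where "\<xi> t = M (u t)" for t
  \<comment> \<open>\<open>harnack\<close> for \<open>t\<close> bounds the logarithm from above;
    \<open>harnack\<close> for \<open>inv t\<close>, applied at the point
    \<open>t \<otimes> x\<close>, bounds it from below.\<close>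
  have u_B: "u t \<in> B" if t: "t \<in> carrier G" for t
  proof -
    obtain c where c: "h (t \<otimes> x) \<le> c * h x" if "x \<in> carrier G" for x
      using harnack[OF t] by blast
    obtain d where d: "h (inv t \<otimes> x) \<le> d * h x" if "x \<in> carrier G" for x
      using harnack[OF inv_closed[OF t]] by blast
    have "\<bar>u t x\<bar> \<le> \<bar>ln c\<bar> + \<bar>ln d\<bar>" if x: "x \<in> carrier G" for x
    proof -
      have px: "h x > 0" "h (t \<otimes> x) > 0" using pos t x by auto
      have 1: "h (t \<otimes> x) / h x \<le> c" using c[OF x] px by (simp add: field_simps)
      have "h x \<le> d * h (t \<otimes> x)"
        using d[of "t \<otimes> x"] t x by (simp add: m_assoc[symmetric])
      then have 2: "h x / h (t \<otimes> x) \<le> d" using px by (simp add: field_simps)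
      have "u t x \<le> ln c"
        unfolding u_def using 1 px by (intro ln_mono) auto
      moreover have "- u t x = ln (h x / h (t \<otimes> x))"
        unfolding u_def using px by (simp add: ln_div)
      moreover have "ln (h x / h (t \<otimes> x)) \<le> ln d"
        using 2 px by (intro ln_mono) auto
      ultimately show ?thesis by linarith
    qed
    then show ?thesis by (rule B_I)
  qed
  have \<xi>_add: "\<xi> (s \<otimes> t) = \<xi> s + \<xi> t" if st: "s \<in> carrier G" "t \<in> carrier G" for s t
  proof -
    have ut: "(\<lambda>x. u s (t \<otimes> x)) \<in> B"
    proof -
      obtain c where c: "\<forall>x\<in>carrier G. \<bar>u s x\<bar> \<le> c"
        using u_B[OF st(1)] unfolding B_iff by (elim exE)
      show ?thesis
        by (rule B_I[of _ c]) (use c st in simp)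
    qed
    \<comment> \<open>The quotient telescopes through \<open>h (t \<otimes> x)\<close>. Left
      invariance of \<open>M\<close> will remove the translation by \<open>t\<close> from the first
      summand.\<close>
    have "u (s \<otimes> t) x = u s (t \<otimes> x) + u t x" if x: "x \<in> carrier G" for x
      using pos[of x] pos[of "t \<otimes> x"] pos[of "s \<otimes> (t \<otimes> x)"] st x
      by (simp add: u_def m_assoc ln_div)
    then have "\<xi> (s \<otimes> t) = M (\<lambda>x. u s (t \<otimes> x) + u t x)"
      unfolding \<xi>_def using u_B st by (intro M_cong) auto
    also have "\<dots> = \<xi> s + \<xi> t"
      unfolding \<xi>_def using M_add[OF ut u_B[OF st(2)]] M_inv[OF u_B[OF st(1)] st(2)] by simp
    finally show ?thesis .
  qed
  have \<xi>_le: "(\<Sum>i\<in>I. v i * (1 + \<xi> (t i))) \<le> C"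
    if I: "finite I" and v: "\<And>i. i \<in> I \<Longrightarrow> v i \<ge> 0" and t: "\<And>i. i \<in> I \<Longrightarrow> t i \<in> carrier G"
      and le: "\<And>x. x \<in> carrier G \<Longrightarrow> (\<Sum>i\<in>I. v i * h (t i \<otimes> x)) \<le> C * h x"
    for I :: "'i set" and v t C
  proof -
    define f where "f i x = 1 + u (t i) x" for i x
    have f_B: "f i \<in> B" if "i \<in> I" for i
      unfolding f_def using B_add[OF B_const u_B[OF t[OF that]]] .
    have Mf: "M (f i) = 1 + \<xi> (t i)" if "i \<in> I" for i
      unfolding f_def \<xi>_def using M_add[OF B_const u_B[OF t[OF that]], of 1] M_one by simp
    have le': "(\<Sum>i\<in>I. v i * f i x) \<le> C" if x: "x \<in> carrier G" for x
    proof -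
      have "(\<Sum>i\<in>I. v i * f i x) \<le> (\<Sum>i\<in>I. v i * (h (t i \<otimes> x) / h x))"
      proof (intro sum_mono mult_left_mono v)
        fix i assume "i \<in> I"
        then have "h (t i \<otimes> x) / h x > 0" using pos t x by simp
        then show "f i x \<le> h (t i \<otimes> x) / h x"
          unfolding f_def u_def using ln_le_minus_one[of "h (t i \<otimes> x) / h x"] by linarith
      qed
      also have "\<dots> = (\<Sum>i\<in>I. v i * h (t i \<otimes> x)) / h x"
        by (simp add: sum_divide_distrib)
      also have "\<dots> \<le> C"
        using le[OF x] pos[OF x] by (simp add: pos_divide_le_eq)
      finally show ?thesis .
    qed
    have "(\<Sum>i\<in>I. v i * (1 + \<xi> (t i))) = M (\<lambda>x. \<Sum>i\<in>I. v i * f i x)"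
      using M_sum[of I f v] I f_B Mf by simp
    also have "\<dots> \<le> M (\<lambda>x. C)"
      using M_sum[of I f v] I f_B le' B_const by (intro M_mono) auto
    also have "\<dots> = C"
      using M_scale[OF B_const, of C 1] M_one by simp
    finally show ?thesis .
  qed
  show ?thesis
  proof (intro exI[of _ \<xi>] conjI ballI allI impI)
    fix I :: "'i set" and v t C
    assume "finite I" "\<forall>i\<in>I. v i \<ge> 0" "\<forall>i\<in>I. t i \<in> carrier G"
      "\<forall>x\<in>carrier G. (\<Sum>i\<in>I. v i * h (t i \<otimes> x)) \<le> C * h x"
    then show "(\<Sum>i\<in>I. v i * (1 + \<xi> (t i))) \<le> C"
      by (intro \<xi>_le) simp_all
  qed (rule \<xi>_add)
qed

section \<open>Periodic points and their concatenation\<close>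

lemma infsum_cmult_ennreal:
  fixes f :: "'a \<Rightarrow> ennreal"
  shows "(\<Sum>\<^sub>\<infinity>x\<in>A. c * f x) = c * (\<Sum>\<^sub>\<infinity>x\<in>A. f x)"
proof -
  have "(\<Sum>\<^sub>\<infinity>x\<in>A. c * f x) = (SUP F\<in>{F. finite F \<and> F \<subseteq> A}. c * sum f F)"
    by (subst nonneg_infsum_complete) (simp_all add: sum_distrib_left)
  also have "\<dots> = c * (SUP F\<in>{F. finite F \<and> F \<subseteq> A}. sum f F)"
    by (rule SUP_mult_left_ennreal[symmetric])
  also have "(SUP F\<in>{F. finite F \<and> F \<subseteq> A}. sum f F) = infsum f A"
    by (subst nonneg_infsum_complete) simp_all
  finally show ?thesis .
qed

lemma infsum_le_ennreal:
  fixes f :: "'a \<Rightarrow> ennreal"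
  assumes "\<And>F. finite F \<Longrightarrow> F \<subseteq> A \<Longrightarrow> sum f F \<le> c"
  shows "infsum f A \<le> c"
  by (subst nonneg_infsum_complete) (use assms in \<open>auto intro!: SUP_least\<close>)

lemma infsum_mono_set_ennreal:
  fixes f :: "'a \<Rightarrow> ennreal"
  assumes "A \<subseteq> B"
  shows "infsum f A \<le> infsum f B"
  by (rule infsum_mono_neutral) (use assms in \<open>auto intro: nonneg_summable_on_complete\<close>)

section \<open>The shift, its periodic points and Birkhoff sums\<close>

lemma funpow_shift: "(shift ^^ k) x = (\<lambda>i. x (i + k))"
  by (induction k arbitrary: x) (simp_all add: shift_def funpow_swap1)

lemma funpow_shift_in_shift_space:
  "x \<in> shift_space S A \<Longrightarrow> (shift ^^ k) x \<in> shift_space S A"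
  by (simp add: shift_space_def funpow_shift)

lemma periodic_mod:
  assumes "(shift ^^ n) x = x"
  shows "x i = x (i mod n)"
proof -
  have step: "x (j + n) = x j" for j
    using fun_cong[OF assms, of j] by (simp add: funpow_shift)
  have "x (j + k * n) = x j" for j k
  proof (induction k)
    case (Suc k)
    then show ?case using step[of "j + k * n"] by (simp add: algebra_simps)
  qed simp
  from this[of "i mod n" "i div n"] show ?thesis by simp
qed

lemma periodic_eqI:
  assumes "(shift ^^ n) x = x" "(shift ^^ n) y = y" "n \<ge> 1" "\<And>i. i < n \<Longrightarrow> x i = y i"
  shows "x = y"
proof
  fix i
  show "x i = y i"
    using periodic_mod[OF assms(1), of i] periodic_mod[OF assms(2), of i] assms(3)
      assms(4)[of "i mod n"] by simp
qed

lemma birkhoff_sum_add: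
  "birkhoff_sum \<phi> (n + m) x = birkhoff_sum \<phi> n x + birkhoff_sum \<phi> m ((shift ^^ n) x)"
  by (induction m) (simp_all add: birkhoff_sum_def funpow_shift add_ac)

text \<open>The periodic point whose repeating block is the first \<open>n\<close> symbols of
  \<open>x\<close> followed by the first \<open>m\<close> symbols of \<open>y\<close>. Reducing the
  index first makes the period \<open>n + m\<close> automatic.\<close>

definition cyc_join :: "nat \<Rightarrow> nat \<Rightarrow> (nat \<Rightarrow> 's) \<Rightarrow> (nat \<Rightarrow> 's) \<Rightarrow> nat \<Rightarrow> 's" where
  "cyc_join n m x y i =
     (let j = i mod (n + m) in if j < n then x j else y (j - n))"

text \<open>The Hoelder constants are fixed here so that the distortion bound is one constant
  throughout. Agreement of two points in their first \<open>n\<close> symbols replaces membership in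
  a common cylinder.\<close>

locale markov_extension = group G for G (structure) +
  fixes S :: "'s set" and A :: "'s \<Rightarrow> 's \<Rightarrow> nat" and \<psi> :: "(nat \<Rightarrow> 's) \<Rightarrow> 'a"
    and \<phi> :: "(nat \<Rightarrow> 's) \<Rightarrow> real" and C \<theta> :: real and a :: 's
  assumes \<psi>_carrier: "x \<in> shift_space S A \<Longrightarrow> \<psi> x \<in> carrier G"
    and \<psi>_first: "x \<in> shift_space S A \<Longrightarrow> y \<in> shift_space S A \<Longrightarrow> x 0 = y 0 \<Longrightarrow> \<psi> x = \<psi> y"
    and C_pos: "C > 0" and \<theta>_pos: "\<theta> > 0" and \<theta>_less: "\<theta> < 1"
    and holder: "n \<ge> 1 \<Longrightarrow> x \<in> shift_space S A \<Longrightarrow> y \<in> shift_space S A \<Longrightarrow>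
      (\<And>i. i < n \<Longrightarrow> x i = y i) \<Longrightarrow> \<bar>\<phi> x - \<phi> y\<bar> \<le> C * \<theta> ^ n"
begin

lemma cocycle_closed: "x \<in> shift_space S A \<Longrightarrow> cocycle G \<psi> n x \<in> carrier G"
  by (induction n) (simp_all add: \<psi>_carrier funpow_shift_in_shift_space)

lemma cocycle_cong:
  assumes "x \<in> shift_space S A" "y \<in> shift_space S A" "\<And>i. i < n \<Longrightarrow> x i = y i"
  shows "cocycle G \<psi> n x = cocycle G \<psi> n y"
  using assms
proof (induction n)
  case (Suc n)
  have "\<psi> ((shift ^^ n) x) = \<psi> ((shift ^^ n) y)"
    using Suc.prems by (intro \<psi>_first funpow_shift_in_shift_space) (simp_all add: funpow_shift)
  then show ?case using Suc by simp
qed simp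

lemma cocycle_add:
  assumes x: "x \<in> shift_space S A"
  shows "cocycle G \<psi> (n + m) x = cocycle G \<psi> n x \<otimes> cocycle G \<psi> m ((shift ^^ n) x)"
proof (induction m)
  case 0
  show ?case using cocycle_closed[OF x] by simp
next
  case (Suc m)
  have "(shift ^^ m) ((shift ^^ n) x) = (shift ^^ (n + m)) x"
    by (simp add: funpow_shift add_ac)
  then show ?case
    using Suc cocycle_closed[OF x] cocycle_closed[OF funpow_shift_in_shift_space[OF x]]
      \<psi>_carrier[OF funpow_shift_in_shift_space[OF x]]
    by (simp add: m_assoc)
qed

text \<open>After \<open>j\<close> shifts the two points still agree in \<open>n - j\<close>
  symbols, so the differences are dominated by a geometric series whose sum does not depend on
  \<open>n\<close>.\<close>

lemma birkhoff_sum_distortion: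
  assumes x: "x \<in> shift_space S A" and y: "y \<in> shift_space S A"
    and eq: "\<And>i. i < n \<Longrightarrow> x i = y i"
  shows "\<bar>birkhoff_sum \<phi> n x - birkhoff_sum \<phi> n y\<bar> \<le> C / (1 - \<theta>)"
proof -
  have "\<bar>birkhoff_sum \<phi> n x - birkhoff_sum \<phi> n y\<bar>
      \<le> (\<Sum>j<n. \<bar>\<phi> ((shift ^^ j) x) - \<phi> ((shift ^^ j) y)\<bar>)"
    unfolding birkhoff_sum_def sum_subtractf[symmetric] by (rule sum_abs)
  also have "\<dots> \<le> (\<Sum>j<n. C * \<theta> ^ (n - Suc j))"
  proof (rule sum_mono)
    fix j assume j: "j \<in> {..<n}"
    have "\<bar>\<phi> ((shift ^^ j) x) - \<phi> ((shift ^^ j) y)\<bar> \<le> C * \<theta> ^ (n - j)"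
      using j eq by (intro holder funpow_shift_in_shift_space x y) (auto simp: funpow_shift)
    \<comment> \<open>One power of \<open>\<theta>\<close> is given away so that reversing the order
      of summation yields the exponents \<open>0\<close> to \<open>n - 1\<close>.\<close>
    also have "\<dots> \<le> C * \<theta> ^ (n - Suc j)"
      using C_pos \<theta>_pos \<theta>_less by (intro mult_left_mono power_decreasing) auto
    finally show "\<bar>\<phi> ((shift ^^ j) x) - \<phi> ((shift ^^ j) y)\<bar> \<le> C * \<theta> ^ (n - Suc j)" .
  qed
  also have "\<dots> = C * (\<Sum>j<n. \<theta> ^ j)"
    using sum.nat_diff_reindex[of "\<lambda>j. C * \<theta> ^ j" n] by (simp add: sum_distrib_left)
  also have "\<dots> = C * ((1 - \<theta> ^ n) / (1 - \<theta>))"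
    using \<theta>_less by (simp add: sum_gp_strict)
  also have "\<dots> \<le> C * (1 / (1 - \<theta>))"
    using C_pos \<theta>_pos \<theta>_less by (intro mult_left_mono divide_right_mono) auto
  finally show ?thesis by simp
qed

definition periodic :: "nat \<Rightarrow> (nat \<Rightarrow> 's) set" where
  "periodic n = {x \<in> shift_space S A. (shift ^^ n) x = x \<and> x 0 = a}"

text \<open>Spelled out rather than built on \<open>periodic\<close>: \<open>loops n \<one>\<close>,
  like \<open>kernel_loops\<close> later, is then literally the index set in
  \<open>gurevic_pressure\<close>.\<close>

definition loops :: "nat \<Rightarrow> 'a \<Rightarrow> (nat \<Rightarrow> 's) set" where
  "loops n g = {x \<in> shift_space S A. (shift ^^ n) x = x \<and> x 0 = a \<and> cocycle G \<psi> n x = g}"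

lemma loops_eq: "loops n g = {x \<in> periodic n. cocycle G \<psi> n x = g}"
  by (auto simp: loops_def periodic_def)

lemma periodic_end:
  assumes "x \<in> periodic n"
  shows "x n = a"
proof -
  have "(shift ^^ n) x 0 = x 0" "x 0 = a"
    using assms by (simp_all add: periodic_def)
  then show ?thesis by (simp add: funpow_shift)
qed

text \<open>The end point \<open>i = n\<close> is included because \<open>x n\<close> and
  \<open>y 0\<close> are both \<open>a\<close>. The step across the junction is thus a step of
  \<open>x\<close>.\<close>

lemma cyc_join_left:
  assumes "x \<in> periodic n" "y \<in> periodic m" "m \<ge> 1" "i \<le> n"
  shows "cyc_join n m x y i = x i"
proof (cases "i = n")
  case True
  then show ?thesis
    using periodic_end[OF assms(1)] assms by (simp add: cyc_join_def periodic_def)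
qed (use assms in \<open>simp add: cyc_join_def\<close>)

lemma cyc_join_right:
  assumes "x \<in> periodic n" "y \<in> periodic m" "n \<ge> 1" "i \<le> m"
  shows "cyc_join n m x y (n + i) = y i"
proof (cases "i = m")
  case True
  then show ?thesis
    using periodic_end[OF assms(2)] assms by (simp add: cyc_join_def periodic_def)
qed (use assms in \<open>simp add: cyc_join_def\<close>)

lemma cyc_join_periodic:
  assumes x: "x \<in> periodic n" and y: "y \<in> periodic m" and n: "n \<ge> 1" and m: "m \<ge> 1"
  shows "cyc_join n m x y \<in> periodic (n + m)"
proof -
  let ?z = "cyc_join n m x y"
  have per: "?z (i + (n + m)) = ?z i" for i
    by (simp add: cyc_join_def)
  have z_mod: "?z i = ?z (i mod (n + m))" for i
    by (simp add: cyc_join_def)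
  have z_Suc: "?z (Suc i) = ?z (Suc (i mod (n + m)))" for i
    by (simp add: cyc_join_def mod_Suc_eq)
  have xy: "x \<in> shift_space S A" "y \<in> shift_space S A"
    using x y by (auto simp: periodic_def)
  \<comment> \<open>Each step within one period is a step of \<open>x\<close> or of
    \<open>y\<close>: the last step of the first block leads to \<open>a\<close>, where
    \<open>y\<close> begins, and the last step of the second block returns to \<open>a\<close>,
    where \<open>x\<close> begins.\<close>
  have main: "?z j \<in> S \<and> A (?z j) (?z (Suc j)) = 1" if "j < n + m" for j
  proof (cases "j < n")
    case True
    then show ?thesis
      using cyc_join_left[OF x y m, of j] cyc_join_left[OF x y m, of "Suc j"] xy
      by (simp add: shift_space_def)
  next
    case False
    define k where "k = j - n"
    have "j = n + k" "k < m"
      using False that by (simp_all add: k_def)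
    then show ?thesis
      using cyc_join_right[OF x y n, of k] cyc_join_right[OF x y n, of "Suc k"] xy
      by (simp add: shift_space_def)
  qed
  have "?z i \<in> S \<and> A (?z i) (?z (Suc i)) = 1" for i
    using main[of "i mod (n + m)"] z_mod[of i] z_Suc[of i] n by simp
  then have "?z \<in> shift_space S A"
    by (simp add: shift_space_def)
  moreover have "?z 0 = a"
    using cyc_join_left[OF x y m, of 0] x by (simp add: periodic_def)
  moreover have "(shift ^^ (n + m)) ?z = ?z"
    using per by (simp only: funpow_shift)
  ultimately show ?thesis by (simp add: periodic_def)
qed

lemma cyc_join_tail:
  assumes x: "x \<in> periodic n" and y: "y \<in> periodic m" and n: "n \<ge> 1" and m: "m \<ge> 1"
  shows "cyc_join n m x y \<in> shift_space S A" "(shift ^^ n) (cyc_join n m x y) \<in> shift_space S A"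
    and "i < n \<Longrightarrow> cyc_join n m x y i = x i"
    and "i < m \<Longrightarrow> (shift ^^ n) (cyc_join n m x y) i = y i"
proof -
  show *: "cyc_join n m x y \<in> shift_space S A"
    using cyc_join_periodic[OF assms] by (simp add: periodic_def)
  show "(shift ^^ n) (cyc_join n m x y) \<in> shift_space S A"
    by (rule funpow_shift_in_shift_space[OF *])
  show "cyc_join n m x y i = x i" if "i < n"
    using cyc_join_left[OF x y m] that by simp
  show "(shift ^^ n) (cyc_join n m x y) i = y i" if "i < m"
    using cyc_join_right[OF x y n, of i] that by (simp add: funpow_shift add.commute)
qed

lemma cyc_join_cocycle:
  assumes x: "x \<in> periodic n" and y: "y \<in> periodic m" and n: "n \<ge> 1" and m: "m \<ge> 1"
  shows "cocycle G \<psi> (n + m) (cyc_join n m x y) = cocycle G \<psi> n x \<otimes> cocycle G \<psi> m y"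
proof -
  have "cocycle G \<psi> n (cyc_join n m x y) = cocycle G \<psi> n x"
    using cyc_join_tail[OF assms] x by (intro cocycle_cong) (auto simp: periodic_def)
  moreover have "cocycle G \<psi> m ((shift ^^ n) (cyc_join n m x y)) = cocycle G \<psi> m y"
    using cyc_join_tail[OF assms] y by (intro cocycle_cong) (auto simp: periodic_def)
  ultimately show ?thesis
    using cocycle_add cyc_join_tail(1)[OF assms] by simp
qed

lemma cyc_join_loops:
  assumes "x \<in> loops n g" "y \<in> loops m h" "n \<ge> 1" "m \<ge> 1"
  shows "cyc_join n m x y \<in> loops (n + m) (g \<otimes> h)"
proof -
  have x: "x \<in> periodic n" "cocycle G \<psi> n x = g" and y: "y \<in> periodic m" "cocycle G \<psi> m y = h"
    using assms(1,2) by (simp_all add: loops_eq)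
  show ?thesis
    using cyc_join_periodic[OF x(1) y(1) assms(3,4)] cyc_join_cocycle[OF x(1) y(1) assms(3,4)] x y
    by (simp add: loops_eq)
qed

text \<open>The two blocks can be read off the joined point, and a periodic point is determined by
  its repeating block.\<close>

lemma cyc_join_inject:
  assumes "x \<in> periodic n" "x' \<in> periodic n" "y \<in> periodic m" "y' \<in> periodic m"
    and n: "n \<ge> 1" and m: "m \<ge> 1" and eq: "cyc_join n m x y = cyc_join n m x' y'"
  shows "x = x'" "y = y'"
proof -
  show "x = x'"
  proof (rule periodic_eqI[of n])
    show "x i = x' i" if "i < n" for i
      using cyc_join_tail(3)[OF assms(1,3) n m that] cyc_join_tail(3)[OF assms(2,4) n m that] eq
      by simp
  qed (use assms in \<open>simp_all add: periodic_def\<close>)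
  show "y = y'"
  proof (rule periodic_eqI[of m])
    show "y i = y' i" if "i < m" for i
      using cyc_join_tail(4)[OF assms(1,3) n m that] cyc_join_tail(4)[OF assms(2,4) n m that] eq
      by simp
  qed (use assms in \<open>simp_all add: periodic_def\<close>)
qed

text \<open>One bound from \<open>birkhoff_sum_distortion\<close> for each of the two blocks of a
  concatenation.\<close>

definition distortion :: real where
  "distortion = 2 * (C / (1 - \<theta>))"

lemma cyc_join_birkhoff_sum:
  assumes x: "x \<in> periodic n" and y: "y \<in> periodic m" and n: "n \<ge> 1" and m: "m \<ge> 1"
  shows "birkhoff_sum \<phi> n x + birkhoff_sum \<phi> m y
    \<le> distortion + birkhoff_sum \<phi> (n + m) (cyc_join n m x y)"
proof -
  have "\<bar>birkhoff_sum \<phi> n (cyc_join n m x y) - birkhoff_sum \<phi> n x\<bar> \<le> C / (1 - \<theta>)"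
    using cyc_join_tail[OF assms] x by (intro birkhoff_sum_distortion) (auto simp: periodic_def)
  moreover have "\<bar>birkhoff_sum \<phi> m ((shift ^^ n) (cyc_join n m x y)) - birkhoff_sum \<phi> m y\<bar> \<le> C / (1 - \<theta>)"
    using cyc_join_tail[OF assms] y by (intro birkhoff_sum_distortion) (auto simp: periodic_def)
  ultimately show ?thesis
    unfolding distortion_def birkhoff_sum_add by linarith
qed

section \<open>Weights of loops under concatenation\<close>

definition weight :: "nat \<Rightarrow> (nat \<Rightarrow> 's) \<Rightarrow> real" where
  "weight n x = exp (birkhoff_sum \<phi> n x)"

definition W :: "nat \<Rightarrow> 'a \<Rightarrow> ennreal" where
  "W n g = (\<Sum>\<^sub>\<infinity>x\<in>loops n g. ennreal (weight n x))"

text \<open>Prepending \<open>x\<close> multiplies the cocycle on the left by that of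
  \<open>x\<close>, so it carries the loops counted on the left into \<open>loops (n + m) g\<close>.
  Distinct pairs have distinct joins, and each join costs at most the factor
  \<open>exp distortion\<close>.\<close>

lemma W_cyc_join:
  assumes B: "finite B" "B \<subseteq> periodic n" and n: "n \<ge> 1" and m: "m \<ge> 1" and g: "g \<in> carrier G"
  shows "(\<Sum>x\<in>B. ennreal (weight n x) * W m (inv (cocycle G \<psi> n x) \<otimes> g))
    \<le> ennreal (exp distortion) * W (n + m) g"
proof -
  define L where "L x = loops m (inv (cocycle G \<psi> n x) \<otimes> g)" for x
  define f where "f z = ennreal (exp distortion) * ennreal (weight (n + m) z)" for z
  have L_per: "L x \<subseteq> periodic m" for x
    by (auto simp: L_def loops_eq)
  have sub: "cyc_join n m x ` L x \<subseteq> loops (n + m) g" if x: "x \<in> B" for x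
  proof
    fix z assume "z \<in> cyc_join n m x ` L x"
    then obtain y where y: "y \<in> L x" "z = cyc_join n m x y" by blast
    have c: "cocycle G \<psi> n x \<in> carrier G"
      using x B cocycle_closed by (auto simp: periodic_def)
    have "x \<in> loops n (cocycle G \<psi> n x)"
      using x B by (auto simp: loops_eq)
    from cyc_join_loops[OF this _ n m, of y] y have "z \<in> loops (n + m) (cocycle G \<psi> n x \<otimes> (inv (cocycle G \<psi> n x) \<otimes> g))"
      by (simp add: L_def)
    then show "z \<in> loops (n + m) g"
      using c g by (simp add: m_assoc[symmetric])
  qed
  have "ennreal (weight n x) * W m (inv (cocycle G \<psi> n x) \<otimes> g) \<le> infsum f (cyc_join n m x ` L x)"
    if x: "x \<in> B" for x
  proof -
    have "ennreal (weight n x) * W m (inv (cocycle G \<psi> n x) \<otimes> g)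
      = (\<Sum>\<^sub>\<infinity>y\<in>L x. ennreal (weight n x) * ennreal (weight m y))"
      by (simp add: W_def L_def infsum_cmult_ennreal)
    also have "\<dots> \<le> (\<Sum>\<^sub>\<infinity>y\<in>L x. (f \<circ> cyc_join n m x) y)"
    proof (rule infsum_mono)
      fix y assume "y \<in> L x"
      then have "weight n x * weight m y \<le> exp distortion * weight (n + m) (cyc_join n m x y)"
        using cyc_join_birkhoff_sum[of x n y m] x B L_per n m
        by (auto simp: weight_def exp_add[symmetric])
      then show "ennreal (weight n x) * ennreal (weight m y) \<le> (f \<circ> cyc_join n m x) y"
        by (simp add: f_def ennreal_mult'[symmetric] weight_def)
    qed (simp_all add: nonneg_summable_on_complete)
    also have "\<dots> = infsum f (cyc_join n m x ` L x)"
    proof (rule infsum_reindex[symmetric])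
      show "inj_on (cyc_join n m x) (L x)"
        using cyc_join_inject(2)[of x n x] x B L_per n m by (intro inj_onI) blast
    qed
    finally show ?thesis .
  qed
  then have "(\<Sum>x\<in>B. ennreal (weight n x) * W m (inv (cocycle G \<psi> n x) \<otimes> g))
    \<le> (\<Sum>x\<in>B. infsum f (cyc_join n m x ` L x))"
    by (rule sum_mono)
  \<comment> \<open>The images for different \<open>x\<close> are disjoint, since the first block of
    a join determines \<open>x\<close>.\<close>
  also have "\<dots> = infsum f (\<Union>x\<in>B. cyc_join n m x ` L x)"
  proof (rule sum_infsum[OF B(1)])
    fix x x' assume "x \<in> B" "x' \<in> B" "x \<noteq> x'"
    then show "cyc_join n m x ` L x \<inter> cyc_join n m x' ` L x' = {}"
      using cyc_join_inject(1)[of x n x'] B L_per n m by blast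
  qed (simp add: nonneg_summable_on_complete)
  also have "\<dots> \<le> infsum f (loops (n + m) g)"
    using sub by (intro infsum_mono_set_ennreal) blast
  also have "\<dots> = ennreal (exp distortion) * W (n + m) g"
    unfolding f_def W_def by (rule infsum_cmult_ennreal)
  finally show ?thesis .
qed

end

context markov_extension
begin

section \<open>Transitivity\<close>

text \<open>A path that returns to \<open>a\<close> at time \<open>k\<close> need not be periodic.
  Repeating its first \<open>k\<close> symbols makes it so and keeps the cocycle, which depends on
  these symbols only.\<close>

lemma close_up_loop:
  assumes w: "w \<in> shift_space S A" "w 0 = a" "w k = a" and k: "k \<ge> 1"
  shows "(\<lambda>i. w (i mod k)) \<in> loops k (cocycle G \<psi> k w)"
proof -
  let ?x = "\<lambda>i. w (i mod k)"
  have "A (?x i) (?x (Suc i)) = 1" for i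
  proof (cases "Suc (i mod k) = k")
    case True
    have "A (w (i mod k)) (w (Suc (i mod k))) = 1"
      using w(1) by (simp add: shift_space_def)
    then show ?thesis
      using True w by (simp add: mod_Suc)
  next
    case False
    then show ?thesis
      using w(1) by (simp add: mod_Suc shift_space_def)
  qed
  then have x: "?x \<in> shift_space S A"
    using w(1) by (simp add: shift_space_def)
  moreover have "cocycle G \<psi> k ?x = cocycle G \<psi> k w"
    by (rule cocycle_cong[OF x w(1)]) simp
  ultimately show ?thesis
    using w(2) by (simp add: loops_def funpow_shift)
qed

lemma skew_product_funpow:
  assumes "y \<in> shift_space S A" "g \<in> carrier G"
  shows "(skew_product G \<psi> ^^ n) (y, g) = ((shift ^^ n) y, g \<otimes> cocycle G \<psi> n y)"
  using assms
  by (induction n)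
    (simp_all add: skew_product_def m_assoc cocycle_closed \<psi>_carrier funpow_shift_in_shift_space)

lemma openin_cylinder:
  assumes "x \<in> shift_space S A"
  shows "openin (shift_topology S A) (cylinder S A [x 0])"
proof -
  have "[x 0] \<in> allowed_words S A 1"
    using assms by (simp add: allowed_words_def shift_space_def)
  then show ?thesis
    unfolding shift_topology_def by (intro topology_generated_by_Basis) blast
qed

lemma topspace_shift_topology: "topspace (shift_topology S A) = shift_space S A"
proof
  show "topspace (shift_topology S A) \<subseteq> shift_space S A"
    unfolding shift_topology_def topology_generated_by_topspace by (auto simp: cylinder_def)
  show "shift_space S A \<subseteq> topspace (shift_topology S A)"
  proof
    fix x assume x: "x \<in> shift_space S A"
    then have "x \<in> cylinder S A [x 0]" by (simp add: cylinder_def)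
    then show "x \<in> topspace (shift_topology S A)"
      using openin_subset[OF openin_cylinder[OF x]] by blast
  qed
qed

text \<open>A dense orbit of the skew product meets every set \<open>[a] \<times> {g}\<close>. Two
  visits whose group coordinates differ by the right factor \<open>t\<close> bound a path from
  \<open>a\<close> to \<open>a\<close> with cocycle \<open>t\<close>.\<close>

lemma loops_nonempty_nontrivial:
  assumes trans: "topologically_transitive (skew_topology S A G) (skew_product G \<psi>)"
    and x: "x \<in> shift_space S A" "x 0 = a"
    and t: "t \<in> carrier G" "t \<noteq> \<one>"
  shows "\<exists>n\<ge>1. loops n t \<noteq> {}"
proof -
  have top: "topspace (skew_topology S A G) = shift_space S A \<times> carrier G"
    by (simp add: skew_topology_def topspace_shift_topology)
  obtain p where p: "p \<in> shift_space S A \<times> carrier G"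
    and dense_p: "skew_topology S A G closure_of {(skew_product G \<psi> ^^ n) p | n. True}
      = shift_space S A \<times> carrier G"
    using trans unfolding topologically_transitive_def top by (elim bexE)
  obtain y g0 where y: "y \<in> shift_space S A" "g0 \<in> carrier G" and p_eq: "p = (y, g0)"
    using p by (elim SigmaE)
  note dense = dense_p[unfolded p_eq]
  \<comment> \<open>The singleton \<open>{g}\<close> is open in the discrete topology, so the
    product with the cylinder of \<open>a\<close> is an open neighbourhood of
    \<open>(x, g)\<close>.\<close>
  have visit: "\<exists>n. y n = a \<and> g0 \<otimes> cocycle G \<psi> n y = g" if g: "g \<in> carrier G" for g
  proof -
    let ?U = "cylinder S A [x 0] \<times> {g}"
    have "(x, g) \<in> skew_topology S A G closure_of {(skew_product G \<psi> ^^ n) (y, g0) | n. True}"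
      using dense x g by simp
    then have "\<forall>T. (x, g) \<in> T \<and> openin (skew_topology S A G) T \<longrightarrow>
        (\<exists>q. q \<in> {(skew_product G \<psi> ^^ n) (y, g0) | n. True} \<and> q \<in> T)"
      unfolding in_closure_of by (rule conjunct2)
    moreover have "(x, g) \<in> ?U"
      using x by (simp add: cylinder_def)
    moreover have "openin (skew_topology S A G) ?U"
      using openin_cylinder[OF x(1)] g by (simp add: skew_topology_def openin_prod_Times_iff)
    ultimately have "\<exists>q. q \<in> {(skew_product G \<psi> ^^ n) (y, g0) | n. True} \<and> q \<in> ?U"
      by (elim allE[of _ ?U]) simp
    then obtain n where "(skew_product G \<psi> ^^ n) (y, g0) \<in> ?U"
      by (elim exE conjE CollectE) simp
    then show ?thesis
      using x y by (auto simp: skew_product_funpow cylinder_def funpow_shift)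
  qed
  \<comment> \<open>Measured from the first visit to \<open>a\<close>, every other visit to \<open>a\<close> comes later.\<close>
  define n where "n = (LEAST n. y n = a)"
  obtain n' where "y n' = a"
    using visit[OF one_closed] by blast
  then have n: "y n = a"
    unfolding n_def by (rule LeastI)
  have c: "cocycle G \<psi> k y \<in> carrier G" for k
    by (rule cocycle_closed[OF y(1)])
  obtain m where m: "y m = a" "g0 \<otimes> cocycle G \<psi> m y = g0 \<otimes> cocycle G \<psi> n y \<otimes> t"
    using visit[of "g0 \<otimes> cocycle G \<psi> n y \<otimes> t"] y c t by auto
  have m_eq: "cocycle G \<psi> m y = cocycle G \<psi> n y \<otimes> t"
    using m(2) y c t by (simp add: m_assoc)
  have "n \<le> m"
    unfolding n_def using m(1) by (rule Least_le)
  \<comment> \<open>The two visits carry different group elements because \<open>t\<close> is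
    nontrivial.\<close>
  moreover have "n \<noteq> m"
  proof
    assume "n = m"
    then have "cocycle G \<psi> n y \<otimes> t = cocycle G \<psi> n y \<otimes> \<one>"
      using m_eq c by simp
    then show False
      using c t by (simp del: r_one)
  qed
  ultimately have k: "m - n \<ge> 1" "n + (m - n) = m" by simp_all
  let ?w = "(shift ^^ n) y"
  have w: "?w \<in> shift_space S A"
    by (rule funpow_shift_in_shift_space[OF y(1)])
  have "cocycle G \<psi> n y \<otimes> cocycle G \<psi> (m - n) ?w = cocycle G \<psi> n y \<otimes> t"
    using cocycle_add[OF y(1), of n "m - n"] k m_eq by simp
  then have "cocycle G \<psi> (m - n) ?w = t"
    using c t cocycle_closed[OF w] by simp
  moreover have "?w 0 = a" "?w (m - n) = a"
    using n m k by (simp_all add: funpow_shift)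
  ultimately have "(\<lambda>i. ?w (i mod (m - n))) \<in> loops (m - n) t"
    using close_up_loop[OF w _ _ k(1)] by simp
  then show ?thesis using k(1) by blast
qed

text \<open>For \<open>t = \<one>\<close> the two visits could coincide. There the given periodic
  point is used instead: either its cocycle \<open>u\<close> is already trivial, or it is joined
  with a loop of cocycle \<open>inv u\<close>.\<close>

lemma loops_nonempty:
  assumes trans: "topologically_transitive (skew_topology S A G) (skew_product G \<psi>)"
    and x: "x \<in> periodic N" "N \<ge> 1" and t: "t \<in> carrier G"
  shows "\<exists>n\<ge>1. loops n t \<noteq> {}"
proof -
  define u where "u = cocycle G \<psi> N x"
  have x': "x \<in> shift_space S A" "x 0 = a"
    using x by (simp_all add: periodic_def)
  have u: "u \<in> carrier G" "x \<in> loops N u"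
    using x cocycle_closed x' by (simp_all add: u_def loops_eq)
  show ?thesis
  proof (cases "t = \<one> \<and> u \<noteq> \<one>")
    case True
    then have "inv u \<noteq> \<one>"
      using u by (metis inv_inv inv_one)
    then obtain m z where z: "m \<ge> 1" "z \<in> loops m (inv u)"
      using loops_nonempty_nontrivial[OF trans x', of "inv u"] u by blast
    have "cyc_join N m x z \<in> loops (N + m) \<one>"
      using cyc_join_loops[OF u(2) z(2) x(2) z(1)] u by simp
    then show ?thesis
      using True z(1) by (intro exI[of _ "N + m"]) auto
  next
    case False
    then show ?thesis
      using loops_nonempty_nontrivial[OF trans x' t] u x(2) by blast
  qed
qed

section \<open>The Green function\<close>

text \<open>The series starts at length \<open>1\<close>: at length \<open>0\<close> every point
  starting in \<open>a\<close> would count as a loop with trivial cocycle, and concatenation needs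
  positive lengths.\<close>

definition green :: "real \<Rightarrow> 'a \<Rightarrow> ennreal" where
  "green s g = (\<Sum>m. ennreal (s ^ Suc m) * W (Suc m) g)"

text \<open>Multiplying \<open>W_cyc_join\<close> by \<open>s ^ (n + m)\<close> and summing over
  \<open>m\<close> leaves a tail of the Green series on the right.\<close>

lemma green_cyc_join:
  assumes B: "finite B" "B \<subseteq> periodic n" and n: "n \<ge> 1" and s: "s > 0" and g: "g \<in> carrier G"
  shows "ennreal (s ^ n) * (\<Sum>x\<in>B. ennreal (weight n x) * green s (inv (cocycle G \<psi> n x) \<otimes> g))
    \<le> ennreal (exp distortion) * green s g"
proof -
  let ?g = "\<lambda>x. inv (cocycle G \<psi> n x) \<otimes> g"
  let ?f = "\<lambda>m. ennreal (s ^ Suc m) * W (Suc m) g"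
  have "(\<Sum>x\<in>B. ennreal (weight n x) * green s (?g x))
    = (\<Sum>x\<in>B. \<Sum>m. ennreal (weight n x) * (ennreal (s ^ Suc m) * W (Suc m) (?g x)))"
    unfolding green_def by simp
  also have "\<dots> = (\<Sum>m. \<Sum>x\<in>B. ennreal (weight n x) * (ennreal (s ^ Suc m) * W (Suc m) (?g x)))"
    by (rule suminf_sum[symmetric]) (rule summableI)
  also have "\<dots> = (\<Sum>m. ennreal (s ^ Suc m) * (\<Sum>x\<in>B. ennreal (weight n x) * W (Suc m) (?g x)))"
    by (simp only: sum_distrib_left mult.left_commute)
  also have "\<dots> \<le> (\<Sum>m. ennreal (s ^ Suc m) * (ennreal (exp distortion) * W (n + Suc m) g))"
    by (intro suminf_le mult_left_mono W_cyc_join B n g summableI) simp_all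
  finally have "ennreal (s ^ n) * (\<Sum>x\<in>B. ennreal (weight n x) * green s (?g x))
    \<le> ennreal (s ^ n) * (\<Sum>m. ennreal (s ^ Suc m) * (ennreal (exp distortion) * W (n + Suc m) g))"
    by (rule mult_left_mono) simp
  also have "\<dots> = (\<Sum>m. ennreal (exp distortion) * ?f (m + n))"
  proof -
    have "ennreal (s ^ n) * (ennreal (s ^ Suc m) * (ennreal (exp distortion) * W (n + Suc m) g))
      = ennreal (exp distortion) * ?f (m + n)" for m
    proof -
      have "ennreal (s ^ Suc (m + n)) = ennreal (s ^ n) * ennreal (s ^ Suc m)"
        using s by (simp add: ennreal_mult'[symmetric] power_add mult_ac)
      then show ?thesis by (simp add: mult_ac add.commute)
    qed
    then show ?thesis by (simp only: ennreal_suminf_cmult[symmetric])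
  qed
  also have "\<dots> = ennreal (exp distortion) * (\<Sum>m. ?f (m + n))"
    by (rule ennreal_suminf_cmult)
  \<comment> \<open>The omitted first \<open>n\<close> terms are nonnegative.\<close>
  also have "\<dots> \<le> ennreal (exp distortion) * green s g"
    unfolding green_def using suminf_offset[OF summableI, of ?f n]
    by (intro mult_left_mono) (simp_all add: le_iff_add)
  finally show ?thesis .
qed

lemma green_loop:
  assumes x: "x \<in> loops n t" and n: "n \<ge> 1" and s: "s > 0"
    and t: "t \<in> carrier G" and g: "g \<in> carrier G"
  shows "ennreal (s ^ n * weight n x) * green s (inv t \<otimes> g) \<le> ennreal (exp distortion) * green s g"
  using green_cyc_join[of "{x}" n s g] assms
  by (simp add: loops_eq ennreal_mult' mult.assoc)

text \<open>A loop with cocycle \<open>inv g\<close>, prepended to the loops with cocycle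
  \<open>g\<close>, gives loops with trivial cocycle. Hence \<open>green s g\<close> is at most a
  constant times \<open>green s \<one>\<close>.\<close>

lemma green_finite:
  assumes loops: "\<And>t. t \<in> carrier G \<Longrightarrow> \<exists>n\<ge>1. loops n t \<noteq> {}"
    and s: "s > 0" and fin: "green s \<one> < Orderings.top" and g: "g \<in> carrier G"
  shows "green s g < Orderings.top"
proof -
  obtain n x where x: "n \<ge> 1" "x \<in> loops n (inv g)"
    using loops[of "inv g"] g by blast
  have "ennreal (s ^ n * weight n x) * green s g \<le> ennreal (exp distortion) * green s \<one>"
    using green_loop[OF x(2,1) s, of \<one>] g by simp
  also have "\<dots> < Orderings.top"
    using fin by (simp add: ennreal_mult_less_top)
  finally show ?thesis
    using s by (auto simp: ennreal_mult_less_top weight_def)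
qed

lemma green_pos:
  assumes x: "x \<in> loops n g" and n: "n \<ge> 1" and s: "s > 0"
  shows "green s g > 0"
proof -
  have "0 < ennreal (weight n x)"
    by (simp add: weight_def)
  also have "\<dots> = (\<Sum>\<^sub>\<infinity>x\<in>{x}. ennreal (weight n x))"
    by simp
  also have "\<dots> \<le> W n g"
    unfolding W_def by (rule infsum_mono_set_ennreal) (use x in simp)
  finally have W: "W (Suc (n - 1)) g > 0"
    using n by simp
  have "0 < ennreal (s ^ Suc (n - 1)) * W (Suc (n - 1)) g"
    using W s by (simp add: ennreal_zero_less_mult_iff del: power_Suc)
  also have "\<dots> \<le> green s g"
    unfolding green_def
    using sum_le_suminf[OF summableI, of "{n - 1}" "\<lambda>m. ennreal (s ^ Suc m) * W (Suc m) g"] by simp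
  finally show ?thesis .
qed

text \<open>\<open>amenable_character\<close> is applied to the Green function with the inverse
  cocycles of the points of \<open>B\<close> as translations. On these the character vanishes, so
  the linearized bound is a bound on the plain sum of the weights.\<close>

lemma kernel_weight_le:
  assumes amen: "amenable_group G"
    and trans: "topologically_transitive (skew_topology S A G) (skew_product G \<psi>)"
    and s: "s > 0" and fin: "green s \<one> < Orderings.top"
    and B: "finite B" "B \<subseteq> periodic n" and n: "n \<ge> 1"
    and ker: "\<And>x. x \<in> B \<Longrightarrow> tf_proj G (cocycle G \<psi> n x) = \<one>\<^bsub>tf_abelianization G\<^esub>"
  shows "(\<Sum>x\<in>B. weight n x) \<le> exp distortion / s ^ n"
\<comment> \<open>A member of \<open>B\<close> supplies the periodic point at \<open>a\<close> that
  \<open>loops_nonempty\<close> asks for.\<close>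
proof (cases "B = {}")
  case True
  then show ?thesis using s by simp
next
  case False
  then obtain x0 where x0: "x0 \<in> periodic n" using B by blast
  have loops: "\<exists>n\<ge>1. loops n t \<noteq> {}" if "t \<in> carrier G" for t
    by (rule loops_nonempty[OF trans x0 n that])
  define h where "h g = enn2real (green s g)" for g
  have green_h: "green s g = ennreal (h g)" if "g \<in> carrier G" for g
    using green_finite[OF loops s fin that] by (simp add: h_def)
  have h_nonneg: "h g \<ge> 0" for g
    by (simp add: h_def)
  have h_pos: "h g > 0" if g: "g \<in> carrier G" for g
  proof -
    obtain m x where "m \<ge> 1" "x \<in> loops m g"
      using loops[OF g] by blast
    from green_pos[OF this(2,1) s] show ?thesis
      using green_h[OF g] h_nonneg[of g] by simp
  qed
  have harnack: "\<exists>c. \<forall>g\<in>carrier G. h (t \<otimes> g) \<le> c * h g" if t: "t \<in> carrier G" for t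
  proof -
    obtain m x where x: "m \<ge> 1" "x \<in> loops m (inv t)"
      using loops[of "inv t"] t by blast
    \<comment> \<open>Prepending the loop with cocycle \<open>inv t\<close> turns loops with cocycle
      \<open>t \<otimes> g\<close> into loops with cocycle \<open>g\<close>; \<open>v\<close> is the
      price per loop, up to distortion.\<close>
    define v where "v = s ^ m * weight m x"
    have v: "v > 0" using s by (simp add: v_def weight_def)
    have "h (t \<otimes> g) \<le> exp distortion / v * h g" if g: "g \<in> carrier G" for g
    proof -
      have "ennreal v * ennreal (h (t \<otimes> g)) \<le> ennreal (exp distortion) * ennreal (h g)"
        using green_loop[OF x(2,1) s _ g] t g green_h by (simp add: v_def)
      then have "v * h (t \<otimes> g) \<le> exp distortion * h g"
        using v h_nonneg[of g] by (simp add: ennreal_mult'[symmetric])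
      then show ?thesis using v by (simp add: field_simps)
    qed
    then show ?thesis by (intro exI[of _ "exp distortion / v"]) simp
  qed
  have c: "cocycle G \<psi> n x \<in> carrier G" if "x \<in> B" for x
    using that B cocycle_closed by (auto simp: periodic_def)
  obtain \<xi> :: "'a \<Rightarrow> real" where
    \<xi>: "(\<forall>x\<in>carrier G. \<forall>y\<in>carrier G. \<xi> (x \<otimes> y) = \<xi> x + \<xi> y) \<and>
    (\<forall>(I :: (nat \<Rightarrow> 's) set) v t C. finite I \<longrightarrow> (\<forall>i\<in>I. v i \<ge> 0) \<longrightarrow> (\<forall>i\<in>I. t i \<in> carrier G) \<longrightarrow>
       (\<forall>x\<in>carrier G. (\<Sum>i\<in>I. v i * h (t i \<otimes> x)) \<le> C * h x) \<longrightarrow>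
       (\<Sum>i\<in>I. v i * (1 + \<xi> (t i))) \<le> C)"
    by (rule exE[OF amenable_character[OF amen h_pos harnack]]) (assumption, assumption, rule that)
  have \<xi>_add: "\<xi> (x \<otimes> y) = \<xi> x + \<xi> y" if "x \<in> carrier G" "y \<in> carrier G" for x y
    using \<xi> that by simp
  have "(\<Sum>x\<in>B. weight n x * (1 + \<xi> (inv (cocycle G \<psi> n x)))) \<le> exp distortion / s ^ n"
  \<comment> \<open>What remains of the premises is \<open>green_cyc_join\<close>, read in the reals
    and divided by \<open>s ^ n\<close>.\<close>
  proof (rule conjunct2[OF \<xi>, rule_format, OF B(1)])
    fix g assume g: "g \<in> carrier G"
    let ?F = "\<Sum>x\<in>B. weight n x * h (inv (cocycle G \<psi> n x) \<otimes> g)"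
    have F: "?F \<ge> 0"
      by (intro sum_nonneg mult_nonneg_nonneg h_nonneg) (simp add: weight_def)
    have "(\<Sum>x\<in>B. ennreal (weight n x) * green s (inv (cocycle G \<psi> n x) \<otimes> g)) = ennreal ?F"
      using green_h c g h_nonneg by (simp add: weight_def ennreal_mult'[symmetric] sum_ennreal)
    then have "ennreal (s ^ n) * ennreal ?F \<le> ennreal (exp distortion) * ennreal (h g)"
      using green_cyc_join[OF B n s g] green_h[OF g] by simp
    then have "s ^ n * ?F \<le> exp distortion * h g"
      using s h_nonneg[of g] by (simp add: ennreal_mult'[symmetric])
    then show "?F \<le> exp distortion / s ^ n * h g"
      using s by (simp add: field_simps)
  qed (use c in \<open>simp_all add: weight_def\<close>)
  moreover have "\<xi> (inv (cocycle G \<psi> n x)) = 0" if "x \<in> B" for x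
    using additive_hom_inv[OF \<xi>_add c[OF that]] additive_hom_tf_proj_eq_one[OF \<xi>_add c[OF that] ker[OF that]]
    by simp
  ultimately show ?thesis by simp
qed

section \<open>Loops whose cocycle lies in the kernel of the projection\<close>

lemma cocycle_tf_proj:
  assumes "x \<in> shift_space S A"
  shows "cocycle (tf_abelianization G) (tf_proj G \<circ> \<psi>) n x = tf_proj G (cocycle G \<psi> n x)"
proof (induction n)
  case 0
  show ?case
    using hom_one[OF tf_proj_hom group_axioms group_tf_abelianization] by simp
next
  case (Suc n)
  then show ?case
    using hom_mult[OF tf_proj_hom cocycle_closed[OF assms] \<psi>_carrier[OF funpow_shift_in_shift_space[OF assms]]]
    by simp
qed

definition kernel_loops :: "nat \<Rightarrow> (nat \<Rightarrow> 's) set" where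
  "kernel_loops n = {x \<in> shift_space S A. (shift ^^ n) x = x \<and> x 0 = a \<and>
     cocycle (tf_abelianization G) (tf_proj G \<circ> \<psi>) n x = \<one>\<^bsub>tf_abelianization G\<^esub>}"

definition W_bar :: "nat \<Rightarrow> ennreal" where
  "W_bar n = (\<Sum>\<^sub>\<infinity>x\<in>kernel_loops n. ennreal (weight n x))"

lemma kernel_loops_eq:
  "kernel_loops n = {x \<in> periodic n. tf_proj G (cocycle G \<psi> n x) = \<one>\<^bsub>tf_abelianization G\<^esub>}"
proof (rule Set.set_eqI)
  fix x
  show "x \<in> kernel_loops n \<longleftrightarrow>
      x \<in> {x \<in> periodic n. tf_proj G (cocycle G \<psi> n x) = \<one>\<^bsub>tf_abelianization G\<^esub>}"
    unfolding kernel_loops_def periodic_def mem_Collect_eq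
    by (cases "x \<in> shift_space S A") (simp_all only: cocycle_tf_proj simp_thms conj_assoc)
qed

lemma W_le_W_bar: "W n \<one> \<le> W_bar n"
  unfolding W_def W_bar_def
proof (rule infsum_mono_set_ennreal)
  show "loops n \<one> \<subseteq> kernel_loops n"
  proof
    fix x assume "x \<in> loops n \<one>"
    then have "x \<in> periodic n" "cocycle G \<psi> n x = \<one>"
      by (simp_all add: loops_eq)
    then show "x \<in> kernel_loops n"
      unfolding kernel_loops_eq mem_Collect_eq
      by (simp only: hom_one[OF tf_proj_hom group_axioms group_tf_abelianization])
  qed
qed

text \<open>The bound of \<open>kernel_weight_le\<close> does not depend on the finite set, so it
  passes to the supremum.\<close>

lemma W_bar_le:
  assumes "amenable_group G"
    and "topologically_transitive (skew_topology S A G) (skew_product G \<psi>)"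
    and s: "s > 0" and "green s \<one> < Orderings.top" and "n \<ge> 1"
  shows "W_bar n \<le> ennreal (exp distortion / s ^ n)"
  unfolding W_bar_def
proof (rule infsum_le_ennreal)
  fix F assume F: "finite F" "F \<subseteq> kernel_loops n"
  have "(\<Sum>x\<in>F. weight n x) \<le> exp distortion / s ^ n"
    using F(2) by (intro kernel_weight_le assms F(1)) (simp_all add: kernel_loops_eq subset_iff)
  then show "(\<Sum>x\<in>F. ennreal (weight n x)) \<le> ennreal (exp distortion / s ^ n)"
    by (simp add: sum_ennreal weight_def ennreal_leI)
qed

lemma W_one_mult:
  assumes n: "n \<ge> 1" and m: "m \<ge> 1"
  shows "W n \<one> * W m \<one> \<le> ennreal (exp distortion) * W (n + m) \<one>"
proof -
  have "W n \<one> * W m \<one> = (\<Sum>\<^sub>\<infinity>x\<in>loops n \<one>. W m \<one> * ennreal (weight n x))"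
    unfolding infsum_cmult_ennreal by (simp add: W_def mult.commute)
  also have "\<dots> \<le> ennreal (exp distortion) * W (n + m) \<one>"
  proof (rule infsum_le_ennreal)
    fix B assume B: "finite B" "B \<subseteq> loops n \<one>"
    have c: "cocycle G \<psi> n x = \<one>" if "x \<in> B" for x
      using that B by (auto simp: loops_eq)
    have "B \<subseteq> periodic n" using B by (auto simp: loops_eq)
    from W_cyc_join[OF B(1) this n m one_closed] c
    show "(\<Sum>x\<in>B. W m \<one> * ennreal (weight n x)) \<le> ennreal (exp distortion) * W (n + m) \<one>"
      by (simp add: mult.commute)
  qed
  finally show ?thesis .
qed

text \<open>A bound on the limsup controls only large lengths, whereas the Green series needs every
  term finite. By \<open>W_one_mult\<close>, one infinite term at \<open>n\<close> would make the
  terms at all positive multiples of \<open>n\<close> infinite.\<close>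

lemma W_one_finite:
  assumes ev: "\<forall>m\<ge>n0. W m \<one> < Orderings.top" and n: "n \<ge> 1"
  shows "W n \<one> < Orderings.top"
proof (rule ccontr)
  assume "\<not> W n \<one> < Orderings.top"
  then have top: "W n \<one> = Orderings.top" by (simp flip: less_top)
  have "W (n * Suc k) \<one> = Orderings.top" for k
  proof (induction k)
    case (Suc k)
    have "Orderings.top \<le> ennreal (exp distortion) * W (n + n * Suc k) \<one>"
      using W_one_mult[OF n, of "n * Suc k"] n Suc top by simp
    then show ?case
      by (simp add: top_unique ennreal_mult_eq_top_iff)
  qed (use top in simp)
  moreover have "n0 \<le> n * Suc n0"
    using n by (cases n) auto
  ultimately show False
    using ev by (metis less_irrefl)
qed

end

section \<open>Exponential growth rates\<close>

lemma eln_mono: "v \<le> w \<Longrightarrow> eln v \<le> eln w"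
proof -
  assume "v \<le> w"
  then show ?thesis
  proof (cases "v = 0 \<or> w = \<infinity>")
    case False
    then have w: "w < Orderings.top" "0 < v" by (auto simp: less_top zero_less_iff_neq_zero)
    with \<open>v \<le> w\<close> have "v < Orderings.top" "w > 0" by auto
    moreover have "enn2real v \<le> enn2real w"
      using \<open>v \<le> w\<close> w(1) by (rule enn2real_mono)
    moreover have "0 < enn2real v"
      using w \<open>v < Orderings.top\<close> by (simp add: enn2real_positive_iff)
    ultimately show ?thesis
      using False by (auto simp: eln_def)
  qed (auto simp: eln_def)
qed

lemma eln_ennreal: "x > 0 \<Longrightarrow> eln (ennreal x) = ereal (ln x)"
  by (simp add: eln_def)

text \<open>The length must be positive: \<open>1 / real 0\<close> is \<open>0\<close>, and the
  inequality would say nothing about \<open>w\<close>.\<close>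

lemma le_exp_of_eln_less:
  assumes less: "ereal (1 / real n) * eln w < ereal r" and n: "n \<ge> 1"
  shows "w \<le> ennreal (exp (real n * r))"
proof (cases w)
  case (real x)
  show ?thesis
  proof (cases "x = 0")
    case False
    then have x: "x > 0" using real by simp
    then have "ln x / real n < r"
      using less real by (simp add: eln_ennreal)
    then have "ln x \<le> real n * r"
      using n by (simp add: field_simps)
    then have "x \<le> exp (real n * r)"
      using x by (metis exp_le_cancel_iff exp_ln)
    then show ?thesis using real by (simp add: ennreal_leI)
  qed (use real in simp)
next
  case top
  then show ?thesis using less n by (simp add: eln_def)
qed

section \<open>Comparison of the two growth rates\<close>

context markov_extension
begin

text \<open>Were the claim false, a real \<open>r\<close> would lie strictly between the two rates.
  The Green series at \<open>s = exp (- r)\<close> converges at \<open>\<one>\<close>, and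
  \<open>W_bar_le\<close> then bounds the larger rate by \<open>r\<close>.\<close>

lemma limsup_W_bar_le:
  assumes amen: "amenable_group G"
    and trans: "topologically_transitive (skew_topology S A G) (skew_product G \<psi>)"
  shows "limsup (\<lambda>n. ereal (1 / real n) * eln (W_bar n)) \<le> limsup (\<lambda>n. ereal (1 / real n) * eln (W n \<one>))"
    (is "?Q \<le> ?P")
proof (rule ccontr)
  assume "\<not> ?Q \<le> ?P"
  then have "?P < ?Q" by (simp only: not_le)
  then have "\<exists>r. ?P < ereal r \<and> ereal r < ?Q" by (rule ereal_dense2)
  then obtain r where r: "?P < ereal r" "ereal r < ?Q"
    by (elim exE conjE)
  \<comment> \<open>The gap between \<open>r'\<close> and \<open>r\<close> provides the ratio
    \<open>exp (r' - r) < 1\<close> of a dominating geometric series.\<close>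
  have "\<exists>r'. ?P < ereal r' \<and> ereal r' < ereal r"
    by (rule ereal_dense2[OF r(1)])
  then obtain r' where r': "?P < ereal r'" "ereal r' < ereal r"
    by (elim exE conjE)
  have r'_less: "r' < r" using r'(2) by simp
  define s where "s = exp (- r)"
  have s: "s > 0" by (simp add: s_def)
  have "\<forall>\<^sub>F n in sequentially. ereal (1 / real n) * eln (W n \<one>) < ereal r'"
    using Limsup_lessD[OF r'(1)] .
  then obtain n1 where n1: "\<forall>n\<ge>n1. ereal (1 / real n) * eln (W n \<one>) < ereal r'"
    unfolding eventually_sequentially by (elim exE)
  have W_le: "W n \<one> \<le> ennreal (exp (real n * r'))" if "n \<ge> Suc n1" for n
    using le_exp_of_eln_less[of n "W n \<one>" r'] n1 that by simp
  have W_fin: "W n \<one> < Orderings.top" if "n \<ge> 1" for n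
  proof (rule W_one_finite[OF _ that])
    show "\<forall>m\<ge>Suc n1. W m \<one> < Orderings.top"
      using W_le by (meson ennreal_less_top le_less_trans)
  qed
  define f where "f m = s ^ Suc m * enn2real (W (Suc m) \<one>)" for m
  have f_nonneg: "f m \<ge> 0" for m
    using s by (simp add: f_def)
  have f_eq: "ennreal (s ^ Suc m) * W (Suc m) \<one> = ennreal (f m)" for m
    using W_fin[of "Suc m"] s by (simp add: f_def ennreal_mult')
  have "summable f"
  proof (rule summable_comparison_test_ev)
    show "\<forall>\<^sub>F m in sequentially. norm (f m) \<le> exp (r' - r) ^ Suc m"
    proof (rule eventually_sequentiallyI[of n1])
      fix m assume "n1 \<le> m"
      then have "enn2real (W (Suc m) \<one>) \<le> exp (real (Suc m) * r')"
        using W_le[of "Suc m"] by (simp add: enn2real_leI)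
      then have "f m \<le> s ^ Suc m * exp (real (Suc m) * r')"
        unfolding f_def using s by (intro mult_left_mono) auto
      also have "\<dots> = exp (r' - r) ^ Suc m"
        unfolding s_def exp_of_nat_mult[symmetric] exp_add[symmetric]
        by (simp add: algebra_simps)
      finally show "norm (f m) \<le> exp (r' - r) ^ Suc m"
        using f_nonneg by simp
    qed
    have "summable (\<lambda>m. exp (r' - r) ^ m)"
      using r'_less by (intro summable_geometric) simp
    then show "summable (\<lambda>m. exp (r' - r) ^ Suc m)"
      by (subst summable_Suc_iff)
  qed
  then have green_one: "green s \<one> < Orderings.top"
    unfolding green_def f_eq using ennreal_suminf_neq_top f_nonneg by (simp add: less_top)
  have bound: "ereal (1 / real n) * eln (W_bar n) \<le> ereal (distortion / real n + r)" if n: "n \<ge> 1" for n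
  proof -
    have "exp distortion / s ^ n = exp (distortion + real n * r)"
      by (simp add: s_def exp_add exp_of_nat_mult exp_minus divide_inverse power_inverse)
    then have "eln (W_bar n) \<le> ereal (distortion + real n * r)"
      using eln_mono[OF W_bar_le[OF amen trans s green_one n]] by (simp add: eln_ennreal)
    then have "ereal (1 / real n) * eln (W_bar n) \<le> ereal (1 / real n) * ereal (distortion + real n * r)"
      by (rule ereal_mult_left_mono) simp
    also have "\<dots> = ereal (distortion / real n + r)"
      using n by (simp add: field_simps)
    finally show ?thesis .
  qed
  have "?Q \<le> limsup (\<lambda>n. ereal (distortion / real n + r))"
    by (intro Limsup_mono eventually_sequentiallyI[of 1] bound)
  also have "\<dots> = ereal r"
  \<comment> \<open>The distortion constant is divided by \<open>n\<close> and disappears in the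
    limit.\<close>
  proof (rule lim_imp_Limsup)
    have "(\<lambda>n. distortion / real n + r) \<longlonglongrightarrow> 0 + r"
      by (intro tendsto_add lim_const_over_n tendsto_const)
    then show "(\<lambda>n. ereal (distortion / real n + r)) \<longlonglongrightarrow> ereal r" by simp
  qed simp
  finally show False using r(2) by simp
qed

lemma gurevic_pressure_eq:
  assumes "amenable_group G"
    and "topologically_transitive (skew_topology S A G) (skew_product G \<psi>)"
  shows "gurevic_pressure S A \<phi> G \<psi> a
    = gurevic_pressure S A \<phi> (tf_abelianization G) (tf_proj G \<circ> \<psi>) a"
proof -
  have "limsup (\<lambda>n. ereal (1 / real n) * eln (W n \<one>)) \<le> limsup (\<lambda>n. ereal (1 / real n) * eln (W_bar n))"
    by (intro Limsup_mono always_eventually allI ereal_mult_left_mono eln_mono W_le_W_bar) simp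
  with limsup_W_bar_le[OF assms]
  have "limsup (\<lambda>n. ereal (1 / real n) * eln (W n \<one>)) = limsup (\<lambda>n. ereal (1 / real n) * eln (W_bar n))"
    by (rule antisym[rotated])
  \<comment> \<open>Once the definitions are unfolded, the two sides are literally the two
    pressures.\<close>
  then show ?thesis
    unfolding gurevic_pressure_def W_def W_bar_def loops_def kernel_loops_def weight_def .
qed

end

theorem theorem1p1:
  fixes S :: "'s set"
    and A :: "'s \<Rightarrow> 's \<Rightarrow> nat"
    and G :: "('g, 'm) monoid_scheme"
    and \<psi> :: "(nat \<Rightarrow> 's) \<Rightarrow> 'g"
    and \<phi> :: "(nat \<Rightarrow> 's) \<Rightarrow> real"
  assumes "countable S"
    and "\<forall>i\<in>S. \<forall>j\<in>S. A i j \<in> {0, 1}"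
    and "group G" and "countable (carrier G)" and "fin_gen_group G"
    and "\<psi> \<in> shift_space S A \<rightarrow> carrier G"
    and "\<forall>x \<in> shift_space S A. \<forall>y \<in> shift_space S A. x 0 = y 0 \<longrightarrow> \<psi> x = \<psi> y"
    and "topologically_transitive (skew_topology S A G) (skew_product G \<psi>)"
    and "locally_Holder S A \<phi>"
    and "amenable_group G"
  shows "\<forall>a\<in>S. gurevic_pressure S A \<phi> G \<psi> a
              = gurevic_pressure S A \<phi> (tf_abelianization G) (tf_proj G \<circ> \<psi>) a"
proof
  fix a assume "a \<in> S"
  obtain C \<theta> where C: "C > 0" and \<theta>: "0 < \<theta>" "\<theta> < 1"
    and holder: "\<forall>n \<ge> 1. \<forall>w \<in> allowed_words S A n. \<forall>x \<in> cylinder S A w. \<forall>y \<in> cylinder S A w.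
           \<bar>\<phi> x - \<phi> y\<bar> \<le> C * \<theta> ^ n"
    using assms(9) unfolding locally_Holder_def by (elim exE conjE)
  have "markov_extension G S A \<psi> \<phi> C \<theta>"
  proof (intro markov_extension.intro markov_extension_axioms.intro assms(3) C \<theta>)
    fix n :: nat and x y
    assume n: "1 \<le> n" and x: "x \<in> shift_space S A" and y: "y \<in> shift_space S A"
      and eq: "\<And>i. i < n \<Longrightarrow> x i = y i"
    \<comment> \<open>The first \<open>n\<close> symbols of \<open>x\<close> form an allowed word
      whose cylinder contains both points, which turns the hypothesis on cylinders into the
      pointwise form of the locale.\<close>
    have word: "map x [0..<n] \<in> allowed_words S A n"
      using x by (auto simp: allowed_words_def shift_space_def)
    have "x \<in> cylinder S A (map x [0..<n])" "y \<in> cylinder S A (map x [0..<n])"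
      using x y eq by (auto simp: cylinder_def)
    then show "\<bar>\<phi> x - \<phi> y\<bar> \<le> C * \<theta> ^ n"
      by (rule holder[rule_format, OF n word])
  next
    fix x assume "x \<in> shift_space S A"
    then show "\<psi> x \<in> carrier G"
      by (rule Pi_mem[OF assms(6)])
  next
    fix x y assume "x \<in> shift_space S A" "y \<in> shift_space S A" "x 0 = y 0"
    then show "\<psi> x = \<psi> y"
      by (rule assms(7)[rule_format])
  qed
  then show "gurevic_pressure S A \<phi> G \<psi> a
      = gurevic_pressure S A \<phi> (tf_abelianization G) (tf_proj G \<circ> \<psi>) a"
    by (rule markov_extension.gurevic_pressure_eq[OF _ assms(10) assms(8)])
qed

end
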